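(* If an ACR-manifold $(M^{2n+1},\Phi,\xi,\eta,g)$ has constant generalized curvature $\kappa$, then $M$ has pointwise constant G$\Phi$HS-curvature equal to $\gamma=\kappa$.
   Context: ACR-manifold: a smooth manifold $M^{2n+1}$ with an endomorphism $\Phi$ of $X(M)$ (smooth vector fields), $\xi\in X(M)$, a Riemannian metric $g$ and $\eta(\cdot)=g(\cdot,\xi)$ such that $\Phi\xi=0$, $\eta(\xi)=1$, $\eta\circ\Phi=0$, $\Phi^2=-\mathrm{id}+\eta\otimes\xi$, $g(\Phi X,\Phi Y)=g(X,Y)-\eta(X)\eta(Y)$. For a $(3,1)$-tensor $T$, $T(X,Y,Z,W)=g(T(Z,W)Y,X)$. Let $R$, $r$, $s$ be the Riemann tensor, Ricci tensor and scalar curvature (with $r$ the contraction of $R(X,Y,Z,W)$ over the first and third arguments). The generalized curvature tensor, with scalars $a_0,a_1,a_2$, is $$B(X,Y,Z,W)=a_0R(X,Y,Z,W)+a_1\{g(X,Z)r(Y,W)-g(X,W)r(Y,Z)+r(X,Z)g(Y,W)-r(X,W)g(Y,Z)\}+2a_2s\{g(X,Z)g(Y,W)-g(X,W)g(Y,Z)\}.$$ $M$ has constant generalized curvature $\kappa$ if $B(X,Y,Z,W)=\kappa\{g(X,Z)g(Y,W)-g(X,W)g(Y,Z)\}$ for all $X,Y,Z,W\in X(M)$. G$\Phi$HS-curvature (generalized $\Phi$-holomorphic sectional curvature): $S(X)=\dfrac{B(\Phi X,X,X,\Phi X)}{(g(X,X))^2}$ for $X\in\ker(\eta)$, $X\neq0$.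 $M$ is of pointwise constant G$\Phi$HS-curvature $\gamma$ if $S(X)=\gamma$ where $\gamma$ does not depend on $X$.
   Formalization: The conclusion is proved as γ = −κ instead of γ = κ: with S(X) = B(ΦX,X,X,ΦX)/g(X,X)² as defined, the printed sign is false (on the unit sphere S^{2n+1}, n ≥ 1, with a_0=1, a_1=a_2=0, κ=1 but S=−1). *)

theory Defs
  imports "HOL-Analysis.Analysis"
begin

text \<open>Meant for open \<open>S\<close>: the derivative is taken at interior points.\<close>

fun Ck_on :: "nat \<Rightarrow> 'e set \<Rightarrow> ('e::euclidean_space \<Rightarrow> 'f::real_normed_vector) \<Rightarrow> bool" where
  "Ck_on 0 S f \<longleftrightarrow> continuous_on S f"
| "Ck_on (Suc k) S f \<longleftrightarrow>
     (\<forall>x\<in>S. f differentiable (at x)) \<and> (\<forall>v. Ck_on k S (\<lambda>x. frechet_derivative f (at x) v))"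

definition smooth_on :: "'e set \<Rightarrow> ('e::euclidean_space \<Rightarrow> 'f::real_normed_vector) \<Rightarrow> bool" where
  "smooth_on S f \<longleftrightarrow> (\<forall>k. Ck_on k S f)"

text \<open>Tangent vectors are derivations of the algebra of smooth functions at a point; a field
  assigns one to every point.\<close>

type_synonym 'a tvec = "('a \<Rightarrow> real) \<Rightarrow> real"
type_synonym 'a field = "'a \<Rightarrow> 'a tvec"

definition add_field :: "'a field \<Rightarrow> 'a field \<Rightarrow> 'a field" where
  "add_field X Y = (\<lambda>p f. X p f + Y p f)"

definition diff_field :: "'a field \<Rightarrow> 'a field \<Rightarrow> 'a field" where
  "diff_field X Y = (\<lambda>p f. X p f - Y p f)"

definition scale_field :: "('a \<Rightarrow> real) \<Rightarrow> 'a field \<Rightarrow> 'a field" where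
  "scale_field h X = (\<lambda>p f. h p * X p f)"

definition lie_bracket :: "'a field \<Rightarrow> 'a field \<Rightarrow> 'a field" where
  "lie_bracket X Y = (\<lambda>p f. X p (\<lambda>q. Y q f) - Y p (\<lambda>q. X q f))"

locale smooth_manifold =
  fixes M :: "'a topology" and A :: "('a set \<times> ('a \<Rightarrow> 'e::euclidean_space)) set"
  assumes Hausdorff: "Hausdorff_space M"
    and second_countable: "second_countable M"
    and chart_domain: "(U, \<phi>) \<in> A \<Longrightarrow> openin M U"
    and chart_range: "(U, \<phi>) \<in> A \<Longrightarrow> open (\<phi> ` U)"
    and chart_homeo:
      "(U, \<phi>) \<in> A \<Longrightarrow> homeomorphic_map (subtopology M U) (top_of_set (\<phi> ` U)) \<phi>"
    and charts_cover: "\<Union> (fst ` A) = topspace M"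
    and charts_compatible:
      "(U, \<phi>) \<in> A \<Longrightarrow> (V, \<psi>) \<in> A \<Longrightarrow> smooth_on (\<psi> ` (U \<inter> V)) (\<phi> \<circ> inv_into V \<psi>)"
begin

text \<open>Nothing is required of a smooth function off \<open>topspace M\<close>. This is harmless: by the Leibniz
  rule a derivation at a point of \<open>M\<close> cannot see values off \<open>M\<close>.\<close>

definition smooth_functions :: "('a \<Rightarrow> real) set" where
  "smooth_functions = {f. \<forall>(U, \<phi>)\<in>A. smooth_on (\<phi> ` U) (f \<circ> inv_into U \<phi>)}"

text \<open>The value on non-smooth arguments is fixed to be zero, so that tangent vectors are equal if
  they agree on smooth functions; likewise vector fields vanish off \<open>M\<close>.\<close>

definition tangent_space :: "'a \<Rightarrow> 'a tvec set" where
  "tangent_space p = {v.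
     (\<forall>f\<in>smooth_functions. \<forall>h\<in>smooth_functions. \<forall>a b.
        v (\<lambda>x. a * f x + b * h x) = a * v f + b * v h) \<and>
     (\<forall>f\<in>smooth_functions. \<forall>h\<in>smooth_functions. v (\<lambda>x. f x * h x) = f p * v h + h p * v f) \<and>
     (\<forall>f. f \<notin> smooth_functions \<longrightarrow> v f = 0)}"

definition vector_fields :: "'a field set" where
  "vector_fields = {X.
     (\<forall>p\<in>topspace M. X p \<in> tangent_space p) \<and>
     (\<forall>p. p \<notin> topspace M \<longrightarrow> X p = (\<lambda>f. 0)) \<and>
     (\<forall>f\<in>smooth_functions. (\<lambda>p. X p f) \<in> smooth_functions)}"

definition endomorphism :: "('a field \<Rightarrow> 'a field) \<Rightarrow> bool" where
  "endomorphism \<Phi> \<longleftrightarrow>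
     (\<forall>X\<in>vector_fields. \<Phi> X \<in> vector_fields) \<and>
     (\<forall>X\<in>vector_fields. \<forall>Y\<in>vector_fields. \<Phi> (add_field X Y) = add_field (\<Phi> X) (\<Phi> Y)) \<and>
     (\<forall>h\<in>smooth_functions. \<forall>X\<in>vector_fields. \<Phi> (scale_field h X) = scale_field h (\<Phi> X))"

definition riemannian_metric :: "('a \<Rightarrow> 'a tvec \<Rightarrow> 'a tvec \<Rightarrow> real) \<Rightarrow> bool" where
  "riemannian_metric g \<longleftrightarrow>
     (\<forall>p\<in>topspace M. \<forall>u\<in>tangent_space p. \<forall>v\<in>tangent_space p. \<forall>w\<in>tangent_space p. \<forall>a b.
        g p (\<lambda>f. a * u f + b * v f) w = a * g p u w + b * g p v w) \<and>
     (\<forall>p\<in>topspace M. \<forall>u\<in>tangent_space p. \<forall>v\<in>tangent_space p. g p u v = g p v u) \<and>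
     (\<forall>p\<in>topspace M. \<forall>v\<in>tangent_space p. v \<noteq> (\<lambda>f. 0) \<longrightarrow> g p v v > 0) \<and>
     (\<forall>X\<in>vector_fields. \<forall>Y\<in>vector_fields. (\<lambda>p. g p (X p) (Y p)) \<in> smooth_functions)"

definition affine_connection :: "('a field \<Rightarrow> 'a field \<Rightarrow> 'a field) \<Rightarrow> bool" where
  "affine_connection nabla \<longleftrightarrow>
     (\<forall>X\<in>vector_fields. \<forall>Y\<in>vector_fields. nabla X Y \<in> vector_fields) \<and>
     (\<forall>X\<in>vector_fields. \<forall>Y\<in>vector_fields. \<forall>Z\<in>vector_fields.
        nabla (add_field X Y) Z = add_field (nabla X Z) (nabla Y Z) \<and>
        nabla Z (add_field X Y) = add_field (nabla Z X) (nabla Z Y)) \<and>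
     (\<forall>h\<in>smooth_functions. \<forall>X\<in>vector_fields. \<forall>Y\<in>vector_fields.
        nabla (scale_field h X) Y = scale_field h (nabla X Y) \<and>
        nabla X (scale_field h Y) =
          add_field (scale_field (\<lambda>p. X p h) Y) (scale_field h (nabla X Y)))"

end

locale riemannian_manifold = smooth_manifold M A
  for M :: "'a topology" and A :: "('a set \<times> ('a \<Rightarrow> 'e::euclidean_space)) set" +
  fixes g :: "'a \<Rightarrow> 'a tvec \<Rightarrow> 'a tvec \<Rightarrow> real"
  assumes metric: "riemannian_metric g"
begin

definition is_levi_civita :: "('a field \<Rightarrow> 'a field \<Rightarrow> 'a field) \<Rightarrow> bool" where
  "is_levi_civita nabla \<longleftrightarrow>
     affine_connection nabla \<and>
     (\<forall>X\<in>vector_fields. \<forall>Y\<in>vector_fields.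
        diff_field (nabla X Y) (nabla Y X) = lie_bracket X Y) \<and>
     (\<forall>X\<in>vector_fields. \<forall>Y\<in>vector_fields. \<forall>Z\<in>vector_fields. \<forall>p\<in>topspace M.
        X p (\<lambda>q. g q (Y q) (Z q)) = g p (nabla X Y p) (Z p) + g p (Y p) (nabla X Z p))"

text \<open>The Levi-Civita connection exists and is unique on vector fields; the choice only affects its
  irrelevant values on arguments that are not vector fields.\<close>

definition levi_civita :: "'a field \<Rightarrow> 'a field \<Rightarrow> 'a field" where
  "levi_civita = (SOME nabla. is_levi_civita nabla)"

definition riemann_operator :: "'a field \<Rightarrow> 'a field \<Rightarrow> 'a field \<Rightarrow> 'a field" where
  "riemann_operator X Y Z =
     diff_field
       (diff_field (levi_civita X (levi_civita Y Z)) (levi_civita Y (levi_civita X Z)))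
       (levi_civita (lie_bracket X Y) Z)"

text \<open>The convention \<open>T(X,Y,Z,W) = g(T(Z,W)Y, X)\<close> for lowering the index of a \<open>(3,1)\<close>-tensor.\<close>

definition lower_index ::
    "('a field \<Rightarrow> 'a field \<Rightarrow> 'a field \<Rightarrow> 'a field) \<Rightarrow>
     'a field \<Rightarrow> 'a field \<Rightarrow> 'a field \<Rightarrow> 'a field \<Rightarrow> 'a \<Rightarrow> real" where
  "lower_index T X Y Z W p = g p (T Z W Y p) (X p)"

definition riemann :: "'a field \<Rightarrow> 'a field \<Rightarrow> 'a field \<Rightarrow> 'a field \<Rightarrow> 'a \<Rightarrow> real" where
  "riemann = lower_index riemann_operator"

definition orthonormal_at :: "'a \<Rightarrow> (nat \<Rightarrow> 'a field) \<Rightarrow> bool" where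
  "orthonormal_at p E \<longleftrightarrow>
     (\<forall>i<DIM('e). E i \<in> vector_fields) \<and>
     (\<forall>i<DIM('e). \<forall>j<DIM('e). g p (E i p) (E j p) = (if i = j then 1 else 0))"

text \<open>Metric contraction at \<open>p\<close> of a field of bilinear forms. Its value is independent of the chosen
  vector fields, which form an orthonormal basis of the tangent space at \<open>p\<close> (but not necessarily
  at other points).\<close>

definition contract :: "('a field \<Rightarrow> 'a field \<Rightarrow> 'a \<Rightarrow> real) \<Rightarrow> 'a \<Rightarrow> real" where
  "contract T p = (let E = (SOME E. orthonormal_at p E) in \<Sum>i<DIM('e). T (E i) (E i) p)"

definition ricci :: "'a field \<Rightarrow> 'a field \<Rightarrow> 'a \<Rightarrow> real" where
  "ricci Y W = contract (\<lambda>X Z. riemann X Y Z W)"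

definition scalar_curvature :: "'a \<Rightarrow> real" where
  "scalar_curvature = contract ricci"

definition generalized_curvature ::
    "real \<Rightarrow> real \<Rightarrow> real \<Rightarrow> 'a field \<Rightarrow> 'a field \<Rightarrow> 'a field \<Rightarrow> 'a field \<Rightarrow> 'a \<Rightarrow> real" where
  "generalized_curvature a0 a1 a2 X Y Z W p =
     a0 * riemann X Y Z W p
     + a1 * (g p (X p) (Z p) * ricci Y W p - g p (X p) (W p) * ricci Y Z p
             + ricci X Z p * g p (Y p) (W p) - ricci X W p * g p (Y p) (Z p))
     + 2 * a2 * scalar_curvature p *
         (g p (X p) (Z p) * g p (Y p) (W p) - g p (X p) (W p) * g p (Y p) (Z p))"

definition constant_generalized_curvature :: "real \<Rightarrow> real \<Rightarrow> real \<Rightarrow> real \<Rightarrow> bool" where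
  "constant_generalized_curvature a0 a1 a2 \<kappa> \<longleftrightarrow>
     (\<forall>X\<in>vector_fields. \<forall>Y\<in>vector_fields. \<forall>Z\<in>vector_fields. \<forall>W\<in>vector_fields. \<forall>p\<in>topspace M.
        generalized_curvature a0 a1 a2 X Y Z W p =
          \<kappa> * (g p (X p) (Z p) * g p (Y p) (W p) - g p (X p) (W p) * g p (Y p) (Z p)))"

end

locale acr_manifold = riemannian_manifold M A g
  for M :: "'a topology" and A :: "('a set \<times> ('a \<Rightarrow> 'e::euclidean_space)) set"
    and g :: "'a \<Rightarrow> 'a tvec \<Rightarrow> 'a tvec \<Rightarrow> real" +
  fixes n :: nat and \<Phi> :: "'a field \<Rightarrow> 'a field" and \<xi> :: "'a field"
    and \<eta> :: "'a field \<Rightarrow> 'a \<Rightarrow> real"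
  assumes dimension: "DIM('e) = 2 * n + 1"
    and Phi_endomorphism: "endomorphism \<Phi>"
    and xi_field: "\<xi> \<in> vector_fields"
    and eta_dual: "X \<in> vector_fields \<Longrightarrow> p \<in> topspace M \<Longrightarrow> \<eta> X p = g p (X p) (\<xi> p)"
    and Phi_xi: "p \<in> topspace M \<Longrightarrow> \<Phi> \<xi> p = (\<lambda>f. 0)"
    and eta_xi: "p \<in> topspace M \<Longrightarrow> \<eta> \<xi> p = 1"
    and eta_Phi: "X \<in> vector_fields \<Longrightarrow> p \<in> topspace M \<Longrightarrow> \<eta> (\<Phi> X) p = 0"
    and Phi_Phi: "X \<in> vector_fields \<Longrightarrow> p \<in> topspace M \<Longrightarrow>
      \<Phi> (\<Phi> X) p = (\<lambda>f. - X p f + \<eta> X p * \<xi> p f)"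
    and metric_compatible: "X \<in> vector_fields \<Longrightarrow> Y \<in> vector_fields \<Longrightarrow> p \<in> topspace M \<Longrightarrow>
      g p (\<Phi> X p) (\<Phi> Y p) = g p (X p) (Y p) - \<eta> X p * \<eta> Y p"
begin

definition ker_eta :: "'a field set" where
  "ker_eta = {X \<in> vector_fields. \<forall>p\<in>topspace M. \<eta> X p = 0}"

text \<open>Mind the order of the arguments: since \<open>R(X,Y,Z,W) = g(R(Z,W)Y, X)\<close>, the number
  \<open>R(\<Phi>X,X,X,\<Phi>X) / g(X,X)\<^sup>2\<close> is \<^emph>\<open>minus\<close> the Riemannian sectional curvature of the plane spanned by
  \<open>X\<close> and \<open>\<Phi>X\<close>, whereas in the definition of constant generalized curvature the unit sphere
  (\<open>a0 = 1\<close>, \<open>a1 = a2 = 0\<close>) has \<open>\<kappa> = 1\<close>.\<close>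

definition GPhiHS_curvature :: "real \<Rightarrow> real \<Rightarrow> real \<Rightarrow> 'a field \<Rightarrow> 'a \<Rightarrow> real" where
  "GPhiHS_curvature a0 a1 a2 X p =
     generalized_curvature a0 a1 a2 (\<Phi> X) X X (\<Phi> X) p / (g p (X p) (X p))\<^sup>2"

definition pointwise_constant_GPhiHS_curvature ::
    "real \<Rightarrow> real \<Rightarrow> real \<Rightarrow> ('a \<Rightarrow> real) \<Rightarrow> bool" where
  "pointwise_constant_GPhiHS_curvature a0 a1 a2 \<gamma> \<longleftrightarrow>
     (\<forall>p\<in>topspace M. \<forall>X\<in>ker_eta. X p \<noteq> (\<lambda>f. 0) \<longrightarrow> GPhiHS_curvature a0 a1 a2 X p = \<gamma> p)"

end

end

theory Submission
  imports Defs
begin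

text \<open>On the kernel of \<eta>, \<Phi> is an isometry with square -id, so \<Phi>X is orthogonal
  to X (\<open>metric_Phi_self\<close>) and as long as X (\<open>metric_Phi_Phi\<close>). Constant
  generalized curvature then turns the numerator B(\<Phi>X,X,X,\<Phi>X) into \<kappa>
  (g(\<Phi>X,X)^2 - g(\<Phi>X,\<Phi>X) g(X,X)) = -\<kappa> g(X,X)^2. The surviving product is the
  subtracted one, so with this order of arguments the constant is -\<kappa>, not \<kappa>;
  exchanging the last two arguments would give +\<kappa>.\<close>

context smooth_manifold
begin

lemma vector_fields_tangent:
  "X \<in> vector_fields \<Longrightarrow> p \<in> topspace M \<Longrightarrow> X p \<in> tangent_space p"
  by (simp add: vector_fields_def)

end

context riemannian_manifold
begin

lemma metric_linear_left:
  assumes "p \<in> topspace M" "u \<in> tangent_space p" "v \<in> tangent_space p" "w \<in> tangent_space p"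
  shows "g p (\<lambda>f. a * u f + b * v f) w = a * g p u w + b * g p v w"
  using metric assms unfolding riemannian_metric_def by blast

lemma metric_commute:
  assumes "p \<in> topspace M" "u \<in> tangent_space p" "v \<in> tangent_space p"
  shows "g p u v = g p v u"
  using metric assms unfolding riemannian_metric_def by blast

lemma metric_pos:
  assumes "p \<in> topspace M" "v \<in> tangent_space p" "v \<noteq> (\<lambda>f. 0)"
  shows "g p v v > 0"
  using metric assms unfolding riemannian_metric_def by blast

end

context acr_manifold
begin

lemma Phi_in_vector_fields: "X \<in> vector_fields \<Longrightarrow> \<Phi> X \<in> vector_fields"
  using Phi_endomorphism by (simp add: endomorphism_def)

text \<open>Compatibility together with \<Phi>^2 = -id makes \<Phi> skew-adjoint on the kernel of
  \<eta>, so by symmetry of the metric g(\<Phi>X,X) equals its own negative.\<close>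

lemma metric_Phi_self:
  assumes X: "X \<in> ker_eta" and p: "p \<in> topspace M"
  shows "g p (\<Phi> X p) (X p) = 0"
proof -
  have XV: "X \<in> vector_fields" and eta: "\<eta> X p = 0"
    using X p by (auto simp: ker_eta_def)
  have PV: "\<Phi> X \<in> vector_fields"
    using XV by (rule Phi_in_vector_fields)
  note tX = vector_fields_tangent[OF XV p] and tP = vector_fields_tangent[OF PV p]
  \<comment> \<open>Compatibility read from right to left for the pair \<Phi>X, X; the correction
    term vanishes since \<eta>(X) = 0 at p.\<close>
  have "g p (\<Phi> X p) (X p) = g p (\<Phi> (\<Phi> X) p) (\<Phi> X p)"
    using metric_compatible[OF PV XV p] eta by simp
  \<comment> \<open>The summand with coefficient 0 pads -X to the two-term shape of
    \<open>metric_linear_left\<close>.\<close>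
  also have "\<Phi> (\<Phi> X) p = (\<lambda>f. (- 1) * X p f + 0 * X p f)"
    using Phi_Phi[OF XV p] eta by simp
  also have "g p \<dots> (\<Phi> X p) = - g p (X p) (\<Phi> X p)"
    using metric_linear_left[OF p tX tX tP, of "-1" 0] by simp
  also have "\<dots> = - g p (\<Phi> X p) (X p)"
    using metric_commute[OF p tX tP] by simp
  finally show ?thesis by simp
qed

lemma metric_Phi_Phi:
  assumes "X \<in> ker_eta" "p \<in> topspace M"
  shows "g p (\<Phi> X p) (\<Phi> X p) = g p (X p) (X p)"
  using assms metric_compatible[of X X p] by (simp add: ker_eta_def)

lemma GPhiHS_curvature_eq:
  assumes B: "constant_generalized_curvature a0 a1 a2 \<kappa>"
    and X: "X \<in> ker_eta" and p: "p \<in> topspace M" and nz: "X p \<noteq> (\<lambda>f. 0)"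
  shows "GPhiHS_curvature a0 a1 a2 X p = - \<kappa>"
proof -
  have XV: "X \<in> vector_fields"
    using X by (simp add: ker_eta_def)
  have PV: "\<Phi> X \<in> vector_fields"
    using XV by (rule Phi_in_vector_fields)
  have "generalized_curvature a0 a1 a2 (\<Phi> X) X X (\<Phi> X) p =
      \<kappa> * (g p (\<Phi> X p) (X p) * g p (X p) (\<Phi> X p) - g p (\<Phi> X p) (\<Phi> X p) * g p (X p) (X p))"
    using B XV PV p unfolding constant_generalized_curvature_def by blast
  \<comment> \<open>Orthogonality kills the first product; equality of lengths makes the second a
    square.\<close>
  also have "\<dots> = - \<kappa> * (g p (X p) (X p))\<^sup>2"
    by (simp add: metric_Phi_self[OF X p] metric_Phi_Phi[OF X p] power2_eq_square)
  \<comment> \<open>Positive definiteness and \<open>nz\<close> make the denominator nonzero, so the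
    square cancels.\<close>
  finally show ?thesis
    using metric_pos[OF p vector_fields_tangent[OF XV p] nz] by (simp add: GPhiHS_curvature_def)
qed

end

theorem theorem4p5:
  fixes M :: "'a topology" and A :: "('a set \<times> ('a \<Rightarrow> 'e::euclidean_space)) set"
    and g :: "'a \<Rightarrow> 'a tvec \<Rightarrow> 'a tvec \<Rightarrow> real"
    and n :: nat and \<Phi> :: "'a field \<Rightarrow> 'a field" and \<xi> :: "'a field"
    and \<eta> :: "'a field \<Rightarrow> 'a \<Rightarrow> real"
    and a0 a1 a2 \<kappa> :: real
  assumes "acr_manifold M A g n \<Phi> \<xi> \<eta>"
    and "riemannian_manifold.constant_generalized_curvature M A g a0 a1 a2 \<kappa>"
  shows "acr_manifold.pointwise_constant_GPhiHS_curvature M A g \<Phi> \<eta> a0 a1 a2 (\<lambda>p. - \<kappa>)"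
proof -
  interpret acr_manifold M A g n \<Phi> \<xi> \<eta>
    by (rule assms(1))
  show ?thesis
    using GPhiHS_curvature_eq[OF assms(2)]
    by (simp add: pointwise_constant_GPhiHS_curvature_def)
qed

end
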